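(* Let $M, N$ be positive integers, let $L_1, L_2, \dots, L_M$ be positive integers, and let $Y \subseteq \mathbb{Z}^N$ be a finite, nonempty set with difference set $X = Y - Y = \{y - y' : y, y' \in Y\}$. Then for every $M \times N$ matrix $A \in (\mathbb{R}/\mathbb{Z})^{MN}$, $$|Y| \prod_{m=1}^M \log (L_m + 1) - \prod_{m=1}^M L_m \le \sum_{\substack{\xi \in X\\ \xi \ne 0}} F_{L}(A\xi).$$
   Context: For $x \in \mathbb{R}/\mathbb{Z}$, $\|x\|$ is the distance from (any real representative of) $x$ to the nearest integer. Elements of $G_1 = (\mathbb{R}/\mathbb{Z})^{MN}$ are written as $M\times N$ matrices $A = (\alpha_{mn})$ with entries in $\mathbb{R}/\mathbb{Z}$; elements of $G_2 = (\mathbb{R}/\mathbb{Z})^M$ are written as column vectors. For a column vector $\xi \in \mathbb{Z}^N$, $A\xi = \bigl(\sum_{n=1}^N \alpha_{mn}\xi_n\bigr)_{1\le m\le M} \in G_2$. The function $F_L : G_2 \to [1,\infty)$ is $$F_L(x) = \prod_{m=1}^M \min\bigl\{L_m, (2\|x_m\|)^{-1}\bigr\},$$ where $(2\|x_m\|)^{-1} = +\infty$ if $\|x_m\|=0$. *)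

theory Defs
  imports "HOL-Analysis.Analysis"
begin

quotient_type circle = real / "\<lambda>x y :: real. x - y \<in> \<int>"
  morphisms rep_circle to_circle
proof (rule equivpI)
  show "reflp (\<lambda>x y :: real. x - y \<in> \<int>)"
    by (simp add: reflp_def)
  show "symp (\<lambda>x y :: real. x - y \<in> \<int>)"
    by (auto simp: symp_def intro: Ints_minus[of "_ - _", simplified])
  show "transp (\<lambda>x y :: real. x - y \<in> \<int>)"
  proof (rule transpI)
    fix x y z :: real
    assume "x - y \<in> \<int>" "y - z \<in> \<int>"
    then have "(x - y) + (y - z) \<in> \<int>" by (rule Ints_add)
    then show "x - z \<in> \<int>" by simp
  qed
qed

instantiation circle :: ab_group_add
begin

lift_definition zero_circle :: circle is "0 :: real" .

lift_definition plus_circle :: "circle \<Rightarrow> circle \<Rightarrow> circle" is "(+) :: real \<Rightarrow> real \<Rightarrow> real"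
proof -
  fix x x' y y' :: real
  assume "x - x' \<in> \<int>" "y - y' \<in> \<int>"
  then have "(x - x') + (y - y') \<in> \<int>" by (rule Ints_add)
  then show "(x + y) - (x' + y') \<in> \<int>" by (simp add: algebra_simps)
qed

lift_definition uminus_circle :: "circle \<Rightarrow> circle" is "uminus :: real \<Rightarrow> real"
proof -
  fix x x' :: real
  assume "x - x' \<in> \<int>"
  then have "- (x - x') \<in> \<int>" by (rule Ints_minus)
  then show "- x - - x' \<in> \<int>" by simp
qed

lift_definition minus_circle :: "circle \<Rightarrow> circle \<Rightarrow> circle" is "(-) :: real \<Rightarrow> real \<Rightarrow> real"
proof -
  fix x x' y y' :: real
  assume "x - x' \<in> \<int>" "y - y' \<in> \<int>"
  then have "(x - x') - (y - y') \<in> \<int>" by (rule Ints_diff)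
  then show "(x - y) - (x' - y') \<in> \<int>" by (simp add: algebra_simps)
qed

instance
  by standard (transfer; simp)+

end

lift_definition int_mult :: "int \<Rightarrow> circle \<Rightarrow> circle" is "\<lambda>k x. of_int k * x"
proof -
  fix k :: int and x x' :: real
  assume "x - x' \<in> \<int>"
  then have "of_int k * (x - x') \<in> \<int>" by (intro Ints_mult) auto
  then show "of_int k * x - of_int k * x' \<in> \<int>" by (simp add: algebra_simps)
qed

lemma infdist_Ints_le:
  fixes x y :: real
  assumes "x - y \<in> \<int>"
  shows "infdist x \<int> \<le> infdist y \<int>"
proof -
  have "infdist x \<int> \<le> dist y k" if "k \<in> \<int>" for k :: real
  proof -
    have "k + (x - y) \<in> \<int>" using that assms by (rule Ints_add)
    then have "infdist x \<int> \<le> dist x (k + (x - y))" by (rule infdist_le)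
    also have "\<dots> = dist y k" by (simp add: dist_real_def)
    finally show ?thesis .
  qed
  moreover have ne: "(\<int> :: real set) \<noteq> {}" using Ints_0 by blast
  ultimately show ?thesis
    unfolding infdist_notempty[OF ne, of y] by (intro cINF_greatest)
qed

lift_definition circle_norm :: "circle \<Rightarrow> real" is "\<lambda>x. infdist x (\<int> :: real set)"
proof -
  fix x y :: real
  assume *: "x - y \<in> \<int>"
  then have "y - x \<in> \<int>" using Ints_minus[OF *] by simp
  with * show "infdist x \<int> = infdist y \<int>"
    by (intro antisym infdist_Ints_le)
qed

definition circle_mat_vec :: "circle ^ 'n ^ 'm \<Rightarrow> int ^ 'n \<Rightarrow> circle ^ 'm" where
  "circle_mat_vec A \<xi> = (\<chi> m. \<Sum>n\<in>UNIV. int_mult (\<xi> $ n) (A $ m $ n))"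

text \<open>Division by zero is zero in HOL, so the convention that the reciprocal of
  twice the norm is infinite at norm zero needs its own case.\<close>

definition F :: "('m::finite \<Rightarrow> nat) \<Rightarrow> circle ^ 'm \<Rightarrow> real" where
  "F L x = (\<Prod>m\<in>UNIV.
     if circle_norm (x $ m) = 0 then real (L m)
     else min (real (L m)) (inverse (2 * circle_norm (x $ m))))"

definition difference_set :: "'a::minus set \<Rightarrow> 'a set" where
  "difference_set Y = {y - y' | y y'. y \<in> Y \<and> y' \<in> Y}"

end

theory Submission
  imports Defs
begin

text \<open>
  The kernel \<open>min {L, 1/(2\<parallel>x\<parallel>)}\<close> has the minorant
  \<open>1 + (\<Sum>k=2..L. max {0, 1 - k\<parallel>x\<parallel>})\<close>. For \<open>k \<ge> 2\<close>, \<open>max {0, 1 - k\<parallel>x - y\<parallel>}\<close> is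
  the probability that \<open>x\<close> and \<open>y\<close> lie in the same cell of a randomly shifted partition of
  the circle into \<open>k\<close> arcs of length \<open>1/k\<close>. Expanding the product of the minorants and shifting
  the coordinates independently, each term is the probability that two points share a cell of
  a partition of the torus into \<open>\<Prod>m. k\<^sub>m\<close> boxes. For every shift at least
  \<open>card Y ^ 2 / (\<Prod>m. k\<^sub>m)\<close> pairs from \<open>Y\<close> do so, by Cauchy--Schwarz, and summing over all
  \<open>k\<^sub>m \<le> L\<^sub>m\<close> produces a product of harmonic numbers, each at least \<open>ln (L\<^sub>m + 1)\<close>.
\<close>

section \<open>Averages of floors over a uniform shift in \<open>[0, 1)\<close>\<close>

definition unit_measure :: "real measure" where
  "unit_measure = restrict_space lborel {0..<1}"

lemma space_unit_measure [simp]: "space unit_measure = {0..<1}"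
  by (simp add: unit_measure_def space_restrict_space)

lemma measure_unit_measure:
  assumes "0 \<le> a" "a \<le> 1"
  shows "measure unit_measure {a..<1} = 1 - a"
  unfolding unit_measure_def using assms by (subst measure_restrict_space) auto

lemma finite_measure_unit: "finite_measure unit_measure"
  by (intro finite_measureI) (simp add: unit_measure_def space_restrict_space emeasure_restrict_space)

lemma measurable_unit_floor [measurable]: "(\<lambda>t. \<lfloor>u + t\<rfloor>) \<in> measurable unit_measure (count_space UNIV)"
  unfolding unit_measure_def by (intro measurable_restrict_space1) simp

lemma integrable_unit_of_bool:
  assumes "Measurable.pred unit_measure P"
  shows "integrable unit_measure (\<lambda>t. of_bool (P t) :: real)"
proof (rule finite_measure.integrable_const_bound[OF finite_measure_unit, where B = 1])
  show "(\<lambda>t. of_bool (P t) :: real) \<in> borel_measurable unit_measure"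
    using assms by measurable
qed auto

text \<open>As \<open>t\<close> runs over \<open>[0, 1)\<close>, the floor jumps at most once, by
  one, at \<open>1 - frac u\<close>. The raised value has probability \<open>frac u\<close>, so the
  mean is \<open>\<lfloor>u\<rfloor> + frac u\<close>.\<close>

lemma integral_floor_shift:
  fixes u :: real
  shows "integrable unit_measure (\<lambda>t. real_of_int \<lfloor>u + t\<rfloor>)"
    and "(\<integral>t. real_of_int \<lfloor>u + t\<rfloor> \<partial>unit_measure) = u"
proof -
  interpret finite_measure unit_measure by (rule finite_measure_unit)
  have eq: "real_of_int \<lfloor>u + t\<rfloor> = real_of_int \<lfloor>u\<rfloor> + indicator {1 - frac u..<1} t"
    if "t \<in> space unit_measure" for t
  proof (cases "t < 1 - frac u")
    case True
    then have "\<lfloor>u + t\<rfloor> = \<lfloor>u\<rfloor>"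
      using that unfolding frac_def by (simp, linarith)
    with True show ?thesis by simp
  next
    case False
    then have "\<lfloor>u + t\<rfloor> = \<lfloor>u\<rfloor> + 1"
      using that frac_lt_1[of u] by (intro floor_unique) (auto simp: frac_def)
    with False that show ?thesis by simp
  qed
  have fr: "0 \<le> frac u" "frac u < 1" by (auto simp: frac_lt_1)
  have S: "{1 - frac u..<1} \<in> sets unit_measure"
    unfolding unit_measure_def using fr by (subst sets_restrict_space_iff) auto
  have int: "integrable unit_measure (indicator {1 - frac u..<1} :: real \<Rightarrow> real)"
    using S by (intro integrable_real_indicator) (auto simp: less_top[symmetric])
  show "integrable unit_measure (\<lambda>t. real_of_int \<lfloor>u + t\<rfloor>)"
    using int by (subst Bochner_Integration.integrable_cong[OF refl eq]) auto
  have "(\<integral>t. real_of_int \<lfloor>u + t\<rfloor> \<partial>unit_measure)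
      = (\<integral>t. real_of_int \<lfloor>u\<rfloor> + indicator {1 - frac u..<1} t \<partial>unit_measure)"
    by (intro Bochner_Integration.integral_cong refl eq)
  also have "\<dots> = real_of_int \<lfloor>u\<rfloor> * measure unit_measure {0..<1} + measure unit_measure {1 - frac u..<1}"
    using int S fr by (simp add: max.absorb1 less_imp_le[OF frac_lt_1])
  also have "\<dots> = u"
    using fr by (simp add: measure_unit_measure) (simp add: frac_def)
  finally show "(\<integral>t. real_of_int \<lfloor>u + t\<rfloor> \<partial>unit_measure) = u" .
qed

lemma integral_same_floor:
  fixes u v :: real
  assumes "\<bar>u - v\<bar> < 1"
  shows "(\<integral>t. of_bool (\<lfloor>u + t\<rfloor> = \<lfloor>v + t\<rfloor>) \<partial>unit_measure) = 1 - \<bar>u - v\<bar>"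
proof -
  have *: "(\<integral>t. of_bool (\<lfloor>u + t\<rfloor> = \<lfloor>v + t\<rfloor>) \<partial>unit_measure) = 1 - (v - u)"
    if uv: "u \<le> v" "v < u + 1" for u v :: real
  proof -
    interpret finite_measure unit_measure by (rule finite_measure_unit)
    \<comment> \<open>The two floors differ by at most one, so the indicator is affine in them.\<close>
    have "of_bool (\<lfloor>u + t\<rfloor> = \<lfloor>v + t\<rfloor>) = 1 - (real_of_int \<lfloor>v + t\<rfloor> - real_of_int \<lfloor>u + t\<rfloor>)" for t
    proof -
      have "\<lfloor>u + t\<rfloor> \<le> \<lfloor>v + t\<rfloor>" "\<lfloor>v + t\<rfloor> \<le> \<lfloor>u + t\<rfloor> + 1"
        using uv by linarith+
      then show ?thesis by auto
    qed
    then show ?thesis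
      using measure_unit_measure[of 0] by (simp add: integral_floor_shift)
  qed
  show ?thesis
  proof (cases "u \<le> v")
    case True
    with *[of u v] assms show ?thesis by simp
  next
    case False
    with *[of v u] assms show ?thesis by (simp add: eq_commute)
  qed
qed

section \<open>Cells of the circle cut into \<open>k\<close> arcs, the shift \<open>t\<close> being
  measured in cell widths \<open>1/k\<close>\<close>

definition cell :: "nat \<Rightarrow> real \<Rightarrow> real \<Rightarrow> int" where
  "cell k t x = \<lfloor>real k * x + t\<rfloor> mod int k"

text \<open>For \<open>k = 1\<close> there is a single cell, so the probability of sharing it is \<open>1\<close> and not
  \<open>1 - r\<close>.\<close>

definition tent :: "nat \<Rightarrow> real \<Rightarrow> real" where
  "tent k r = (if k = 1 then 1 else max 0 (1 - real k * r))"

lemma measurable_cell [measurable]: "(\<lambda>t. cell k t x) \<in> measurable unit_measure (count_space UNIV)"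
  unfolding cell_def by measurable

text \<open>The scaled floor moves by \<open>k * j\<close>, which the reduction mod \<open>k\<close>
  removes; hence cells computed on real representatives are well defined on the circle.\<close>

lemma cell_add_int: "cell k t (x + of_int j) = cell k t x"
proof -
  have "real k * (x + of_int j) + t = (real k * x + t) + of_int (int k * j)"
    by (simp add: algebra_simps)
  then show ?thesis
    unfolding cell_def by (simp only: floor_add_int[symmetric]) simp
qed

text \<open>Floors congruent mod \<open>k\<close> differ by some \<open>k * j\<close>. Translating
  \<open>y\<close> by this \<open>j\<close> makes them equal, and reals with equal floors are less
  than 1 apart.\<close>

lemma cell_eqE:
  assumes "cell k t x = cell k t y"
  obtains j :: int where "\<bar>real k * x - real k * (y + of_int j)\<bar> < 1"
proof -
  from assms have "int k dvd \<lfloor>real k * x + t\<rfloor> - \<lfloor>real k * y + t\<rfloor>"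
    unfolding cell_def by (simp add: mod_eq_dvd_iff)
  then obtain j where j: "\<lfloor>real k * x + t\<rfloor> - \<lfloor>real k * y + t\<rfloor> = int k * j" ..
  then have "real_of_int \<lfloor>real k * x + t\<rfloor> - real_of_int \<lfloor>real k * y + t\<rfloor> = real k * of_int j"
    by (metis of_int_diff of_int_mult of_int_of_nat_eq)
  then have "\<bar>real k * x - real k * (y + of_int j)\<bar> < 1"
    by (simp add: distrib_left) linarith
  then show ?thesis ..
qed

text \<open>Reals less than 1 apart have floors differing by at most 1, and consecutive integers are
  incongruent mod \<open>k\<close> once \<open>k \<ge> 2\<close>.\<close>

lemma cell_eq_iff_floor_eq:
  assumes "k \<ge> 2" "\<bar>real k * x - real k * y\<bar> < 1"
  shows "cell k t x = cell k t y \<longleftrightarrow> \<lfloor>real k * x + t\<rfloor> = \<lfloor>real k * y + t\<rfloor>"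
proof
  assume "cell k t x = cell k t y"
  then have "int k dvd \<lfloor>real k * x + t\<rfloor> - \<lfloor>real k * y + t\<rfloor>"
    unfolding cell_def by (simp add: mod_eq_dvd_iff)
  moreover have "\<bar>\<lfloor>real k * x + t\<rfloor> - \<lfloor>real k * y + t\<rfloor>\<bar> < int k"
    using assms by linarith
  ultimately show "\<lfloor>real k * x + t\<rfloor> = \<lfloor>real k * y + t\<rfloor>"
    using zdvd_not_zless[of "\<bar>\<lfloor>real k * x + t\<rfloor> - \<lfloor>real k * y + t\<rfloor>\<bar>" "int k"] by force
qed (simp add: cell_def)

text \<open>If no shift puts the points in one cell, the integral is 0. If some shift does, an
  integer translate of \<open>y\<close> lies within one cell width of \<open>x\<close> and the
  integral is exact; that translate is no nearer than the distance on the circle, which gives the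
  bound.\<close>

lemma integral_same_cell_le_tent:
  assumes "k \<ge> 1"
  shows "(\<integral>t. of_bool (cell k t x = cell k t y) \<partial>unit_measure) \<le> tent k (infdist (x - y) \<int>)"
proof -
  consider "k = 1" | "k \<ge> 2" "\<And>t. cell k t x \<noteq> cell k t y"
    | t where "k \<ge> 2" "cell k t x = cell k t y"
    using assms by fastforce
  then show ?thesis
  proof cases
    case 1
    then show ?thesis
      using measure_unit_measure[of 0] by (simp add: cell_def tent_def)
  next
    case 2
    then show ?thesis by (simp add: tent_def)
  next
    case 3
    from cell_eqE[OF 3(2)] obtain j :: int where j: "\<bar>real k * x - real k * (y + of_int j)\<bar> < 1" .
    have "(\<integral>t. of_bool (cell k t x = cell k t y) \<partial>unit_measure)
        = (\<integral>t. of_bool (cell k t x = cell k t (y + of_int j)) \<partial>unit_measure)"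
      by (simp add: cell_add_int)
    also have "\<dots> = 1 - \<bar>real k * x - real k * (y + of_int j)\<bar>"
      by (simp add: cell_eq_iff_floor_eq[OF 3(1) j] integral_same_floor[OF j])
    also have "\<dots> = 1 - real k * \<bar>x - y - of_int j\<bar>"
      by (simp add: abs_mult flip: right_diff_distrib diff_diff_eq)
    also have "\<dots> \<le> 1 - real k * infdist (x - y) \<int>"
      using infdist_le[of "of_int j" \<int> "x - y"]
      by (intro diff_left_mono mult_left_mono) (auto simp: dist_real_def)
    also have "\<dots> \<le> tent k (infdist (x - y) \<int>)"
      using 3 by (simp add: tent_def)
    finally show ?thesis .
  qed
qed

section \<open>Pairs sharing a cell, for a fixed shift and on average over shifts of the
  torus\<close>

lemma card_sq_le_same_colour_pairs:
  fixes c :: "'a \<Rightarrow> 'b"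
  assumes "finite Y" "finite C" "c ` Y \<subseteq> C"
  shows "(real (card Y))\<^sup>2 \<le> real (card C) * (\<Sum>y\<in>Y. \<Sum>y'\<in>Y. of_bool (c y = c y'))"
proof -
  \<comment> \<open>Colour class sizes: they sum to \<open>card Y\<close>, their squares count the
    monochromatic pairs, and Cauchy-Schwarz compares the two.\<close>
  define n where "n i = (\<Sum>y\<in>Y. of_bool (c y = i) :: real)" for i
  have "(\<Sum>i\<in>C. n i) = (\<Sum>y\<in>Y. \<Sum>i\<in>C. of_bool (c y = i))"
    unfolding n_def by (rule sum.swap)
  also have "\<dots> = real (card Y)"
    using assms by (subst sum.cong[OF refl, of _ _ "\<lambda>_. 1"]) (auto simp: of_bool_def)
  finally have 1: "(\<Sum>i\<in>C. n i) = real (card Y)" .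
  have "(\<Sum>i\<in>C. (n i)\<^sup>2) = (\<Sum>i\<in>C. \<Sum>y\<in>Y. \<Sum>y'\<in>Y. of_bool (c y = i) * of_bool (c y' = i))"
    unfolding n_def power2_eq_square sum_product ..
  also have "\<dots> = (\<Sum>y\<in>Y. \<Sum>y'\<in>Y. \<Sum>i\<in>C. of_bool (c y = i) * of_bool (c y' = i))"
    by (subst sum.swap, intro sum.cong refl, rule sum.swap)
  also have "\<dots> = (\<Sum>y\<in>Y. \<Sum>y'\<in>Y. of_bool (c y = c y'))"
  proof (intro sum.cong refl)
    fix y y' assume "y \<in> Y" "y' \<in> Y"
    have "(\<Sum>i\<in>C. of_bool (c y = i) * of_bool (c y' = i))
        = (\<Sum>i\<in>C. if c y = i then of_bool (c y = c y') else (0::real))"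
      by (intro sum.cong) auto
    then show "(\<Sum>i\<in>C. of_bool (c y = i) * of_bool (c y' = i)) = (of_bool (c y = c y') :: real)"
      using assms \<open>y \<in> Y\<close> by (auto simp: image_subset_iff)
  qed
  finally show ?thesis
    using sum_squared_le_sum_of_squares[of n C] by (simp add: 1 mult.commute)
qed

lemma prod_of_bool: "finite I \<Longrightarrow> (\<Prod>i\<in>I. of_bool (P i)) = (of_bool (\<forall>i\<in>I. P i) :: 'a :: comm_semiring_1)"
  by (induction I rule: finite_induct) auto

lemma card_sq_le_sum_prod_tent:
  fixes z :: "'a \<Rightarrow> 'm::finite \<Rightarrow> real"
  assumes Y: "finite Y" and k: "\<And>m. k m \<ge> 1"
  shows "(real (card Y))\<^sup>2 * (\<Prod>m\<in>UNIV. 1 / real (k m))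
    \<le> (\<Sum>y\<in>Y. \<Sum>y'\<in>Y. \<Prod>m\<in>UNIV. tent (k m) (infdist (z y m - z y' m) \<int>))"
proof -
  let ?I = "UNIV :: 'm set"
  let ?P = "Pi\<^sub>M ?I (\<lambda>_. unit_measure)"
  interpret finite_measure unit_measure by (rule finite_measure_unit)
  interpret product_sigma_finite "\<lambda>_ :: 'm. unit_measure" ..
  define s where "s y y' m t = (of_bool (cell (k m) t (z y m) = cell (k m) t (z y' m)) :: real)"
    for y y' m t
  define S where "S t = (\<Sum>y\<in>Y. \<Sum>y'\<in>Y. \<Prod>m\<in>?I. s y y' m (t m))" for t
  let ?K = "\<Prod>m\<in>?I. real (k m)"
  have int_s: "integrable unit_measure (s y y' m)" for y y' m
    unfolding s_def by (intro integrable_unit_of_bool) measurable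
  have int_prod: "integrable ?P (\<lambda>t. \<Prod>m\<in>?I. s y y' m (t m))" for y y'
    by (intro product_integrable_prod int_s) simp
  \<comment> \<open>Writing 1 as a product over coordinates reduces the total mass of
    \<open>?P\<close> to that of \<open>unit_measure\<close>.\<close>
  have one: "(\<integral>t. (\<Prod>m\<in>?I. 1) \<partial>?P) = (1::real)" "integrable ?P (\<lambda>t. \<Prod>m\<in>?I. 1::real)"
    using product_integral_prod[of ?I "\<lambda>_ _. 1::real"] product_integrable_prod[of ?I "\<lambda>_ _. 1::real"]
      measure_unit_measure[of 0] by simp_all
  \<comment> \<open>For a fixed shift vector, the colour of \<open>y\<close> is its vector of cells,
    one of \<open>?K\<close> possible boxes.\<close>
  have pointwise: "(real (card Y))\<^sup>2 \<le> ?K * S t" for t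
  proof -
    let ?C = "\<Pi>\<^sub>E m\<in>?I. {0..<int (k m)}"
    have "(real (card Y))\<^sup>2 \<le> real (card ?C) *
       (\<Sum>y\<in>Y. \<Sum>y'\<in>Y. of_bool ((\<lambda>m. cell (k m) (t m) (z y m)) = (\<lambda>m. cell (k m) (t m) (z y' m))))"
    proof (intro card_sq_le_same_colour_pairs Y finite_PiE)
      show "(\<lambda>y m. cell (k m) (t m) (z y m)) ` Y \<subseteq> ?C"
        using k by (fastforce simp: cell_def Suc_le_eq)
    qed auto
    also have "real (card ?C) = ?K"
      by (simp add: card_PiE)
    also have "(\<Sum>y\<in>Y. \<Sum>y'\<in>Y. of_bool ((\<lambda>m. cell (k m) (t m) (z y m)) = (\<lambda>m. cell (k m) (t m) (z y' m)))) = S t"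
      by (simp add: S_def s_def prod_of_bool fun_eq_iff)
    finally show ?thesis .
  qed
  have "(real (card Y))\<^sup>2 = (\<integral>t. (real (card Y))\<^sup>2 * (\<Prod>m\<in>?I. 1) \<partial>?P)"
    by (simp only: integral_mult_right_zero one mult_1_right)
  also have "\<dots> \<le> (\<integral>t. ?K * S t \<partial>?P)"
    unfolding S_def
  proof (intro integral_mono integrable_mult_right one Bochner_Integration.integrable_sum int_prod)
  qed (use pointwise in \<open>simp add: S_def\<close>)
  also have "\<dots> = ?K * (\<Sum>y\<in>Y. \<Sum>y'\<in>Y. \<integral>t. (\<Prod>m\<in>?I. s y y' m (t m)) \<partial>?P)"
    unfolding S_def by (simp add: int_prod)
  \<comment> \<open>The coordinates are shifted independently, so the integral factors.\<close>
  also have "\<dots> = ?K * (\<Sum>y\<in>Y. \<Sum>y'\<in>Y. \<Prod>m\<in>?I. integral\<^sup>L unit_measure (s y y' m))"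
    by (simp add: product_integral_prod int_s)
  also have "\<dots> \<le> ?K * (\<Sum>y\<in>Y. \<Sum>y'\<in>Y. \<Prod>m\<in>?I. tent (k m) (infdist (z y m - z y' m) \<int>))"
    by (intro mult_left_mono sum_mono prod_mono conjI prod_nonneg)
       (auto simp: s_def [abs_def] intro!: integral_same_cell_le_tent k)
  finally have *: "(real (card Y))\<^sup>2 \<le> \<dots>" .
  have "?K > 0"
    by (intro prod_pos) (use k in \<open>auto simp: Suc_le_eq\<close>)
  with * show ?thesis
    by (simp add: prod_dividef divide_le_eq mult.commute)
qed

section \<open>Sums of tents against the one-dimensional kernel\<close>

lemma infdist_Ints_le_half: "infdist (x :: real) \<int> \<le> 1 / 2"
proof -
  have "infdist x \<int> \<le> dist x (of_int (round x))"
    by (intro infdist_le) auto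
  also have "\<dots> \<le> 1 / 2"
    using of_int_round_abs_le[of x] by (simp add: dist_real_def abs_minus_commute)
  finally show ?thesis .
qed

lemma sum_tent_le_card:
  assumes "r \<ge> 0"
  shows "(\<Sum>k=1..l. tent k r) \<le> real l"
proof -
  have "(\<Sum>k=1..l. tent k r) \<le> (\<Sum>k=1..l. 1)"
    using assms by (intro sum_mono) (auto simp: tent_def)
  then show ?thesis by simp
qed

text \<open>While \<open>k * r \<le> 1\<close> the sum is an explicit quadratic in its length, and
  completing the square bounds it. Later tents vanish, so the bound persists by induction.\<close>

lemma sum_tent_le_inverse:
  assumes "0 < r" "r \<le> 1 / 2"
  shows "(\<Sum>k=1..l. tent k r) \<le> inverse (2 * r)"
proof (induction l)
  case 0
  with assms show ?case by simp
next
  case (Suc l)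
  \<comment> \<open>The \<open>- 1\<close> arises because \<open>tent 1 r\<close> is 1 instead of
    \<open>1 - r\<close>, so the coefficients of \<open>r\<close> start at 2.\<close>
  have closed: "(\<Sum>k=1..Suc n. tent k r) = real (Suc n) - r * (real (Suc n) * (real (Suc n) + 1) / 2 - 1)"
    if "real (Suc n) * r \<le> 1" for n
    using that
  proof (induction n)
    case 0
    then show ?case by (simp add: tent_def)
  next
    case (Suc n)
    have "real (Suc n) * r \<le> 1"
      using Suc.prems assms by (simp add: algebra_simps)
    with Suc.IH have "(\<Sum>k=1..Suc n. tent k r) = real (Suc n) - r * (real (Suc n) * (real (Suc n) + 1) / 2 - 1)"
      by blast
    moreover have "tent (Suc (Suc n)) r = 1 - real (Suc (Suc n)) * r"
      using Suc.prems by (simp add: tent_def)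
    ultimately show ?case
      by (simp add: field_simps)
  qed
  show ?case
  proof (cases "real (Suc l) * r \<le> 1 \<and> l \<noteq> 0")
    case True
    define q where "q = real (Suc l)"
    have q: "q \<ge> 2" using True by (simp add: q_def)
    \<comment> \<open>This is 1 minus \<open>2 * r\<close> times the closed form;
      \<open>q \<ge> 2\<close> makes the remainder nonnegative.\<close>
    have "0 \<le> (q * r - 1)\<^sup>2 + r\<^sup>2 * (q - 2)"
      using q by simp
    also have "\<dots> = 1 - (q - r * (q * (q + 1) / 2 - 1)) * (2 * r)"
      by (simp add: power2_eq_square field_simps)
    finally have "(q - r * (q * (q + 1) / 2 - 1)) * (2 * r) \<le> 1"
      by simp
    then have "q - r * (q * (q + 1) / 2 - 1) \<le> inverse (2 * r)"
      using assms by (simp add: field_simps)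
    then show ?thesis
      using closed[of l] True unfolding q_def by simp
  next
    case False
    then consider "l = 0" | "real (Suc l) * r > 1" by force
    then show ?thesis
    proof cases
      case 1
      then show ?thesis using assms by (simp add: tent_def field_simps)
    next
      case 2
      \<comment> \<open>Here \<open>r \<le> 1/2\<close> rules out the first tent, the only one that
        never vanishes.\<close>
      moreover have "Suc l \<noteq> 1" using 2 assms by (cases "l = 0") auto
      ultimately have "tent (Suc l) r = 0" by (simp add: tent_def)
      then show ?thesis using Suc by simp
    qed
  qed
qed

section \<open>Real representatives of circle elements, and the function \<open>F\<close>\<close>

lemma circle_norm_diff: "circle_norm (a - b) = infdist (rep_circle a - rep_circle b) \<int>"
  by (metis Quotient3_abs_rep Quotient3_circle minus_circle.abs_eq circle_norm.abs_eq)

lemma circle_norm_bounds: "0 \<le> circle_norm x" "circle_norm x \<le> 1 / 2"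
  by (simp_all only: circle_norm.rep_eq infdist_nonneg infdist_Ints_le_half)

lemma int_mult_diff: "int_mult (j - k) x = int_mult j x - int_mult k x"
  by transfer (simp add: algebra_simps)

lemma circle_mat_vec_diff: "circle_mat_vec A (\<xi> - \<eta>) = circle_mat_vec A \<xi> - circle_mat_vec A \<eta>"
  by (simp add: circle_mat_vec_def vec_eq_iff int_mult_diff sum_subtractf)

text \<open>At norm zero only the bound by \<open>L m\<close> is available, matching the separate
  case in \<open>F\<close>; elsewhere both bounds of the minimum hold.\<close>

lemma prod_sum_tent_le_F:
  "(\<Prod>m\<in>UNIV. \<Sum>k=1..L m. tent k (circle_norm (x $ m))) \<le> F L x"
  unfolding F_def
proof (intro prod_mono conjI sum_nonneg)
  fix m
  show "(\<Sum>k=1..L m. tent k (circle_norm (x $ m)))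
    \<le> (if circle_norm (x $ m) = 0 then real (L m)
        else min (real (L m)) (inverse (2 * circle_norm (x $ m))))"
    using sum_tent_le_card[of "circle_norm (x $ m)" "L m"] circle_norm_bounds[of "x $ m"]
      sum_tent_le_inverse[of "circle_norm (x $ m)" "L m"] by auto
qed (simp add: tent_def)

lemma F_nonneg: "F L x \<ge> 0"
  using circle_norm_bounds by (auto simp: F_def intro!: prod_nonneg)

lemma F_zero: "F L 0 = (\<Prod>m\<in>UNIV. real (L m))"
proof -
  have "circle_norm 0 = 0"
    by transfer simp
  then show ?thesis by (simp add: F_def)
qed

text \<open>For fixed \<open>y\<close> the map \<open>y' \<mapsto> y - y'\<close> is injective, so
  each inner sum runs over distinct differences and is at most the sum over the whole difference
  set.\<close>

lemma sum_differences_le: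
  fixes g :: "'a::ab_group_add \<Rightarrow> real"
  assumes "finite Y" "\<And>x. g x \<ge> 0"
  shows "(\<Sum>y\<in>Y. \<Sum>y'\<in>Y. g (y - y')) \<le> real (card Y) * (g 0 + (\<Sum>\<xi>\<in>difference_set Y - {0}. g \<xi>))"
proof -
  have "difference_set Y = (\<lambda>(y, y'). y - y') ` (Y \<times> Y)"
    by (auto simp: difference_set_def)
  then have fin: "finite (difference_set Y)"
    using assms by simp
  have "(\<Sum>y'\<in>Y. g (y - y')) \<le> g 0 + (\<Sum>\<xi>\<in>difference_set Y - {0}. g \<xi>)" if "y \<in> Y" for y
  proof -
    have "(\<Sum>y'\<in>Y. g (y - y')) = (\<Sum>\<xi>\<in>(\<lambda>y'. y - y') ` Y. g \<xi>)"
      by (subst sum.reindex) (auto simp: inj_on_def)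
    also have "\<dots> \<le> (\<Sum>\<xi>\<in>difference_set Y. g \<xi>)"
      using that fin assms by (intro sum_mono2) (auto simp: difference_set_def)
    also have "\<dots> = g 0 + (\<Sum>\<xi>\<in>difference_set Y - {0}. g \<xi>)"
      using that fin by (intro sum.remove) (auto simp: difference_set_def)
    finally show ?thesis .
  qed
  from sum_mono[OF this] show ?thesis by simp
qed

section \<open>Summation over all cell counts up to \<open>L m\<close>\<close>

theorem theorem1p1:
  fixes L :: "'m::finite \<Rightarrow> nat"
    and Y :: "(int ^ 'n::finite) set"
    and A :: "circle ^ 'n ^ 'm"
  assumes "\<And>m. L m \<ge> 1"
    and "finite Y" and "Y \<noteq> {}"
  shows "real (card Y) * (\<Prod>m\<in>UNIV. ln (real (L m) + 1)) - (\<Prod>m\<in>UNIV. real (L m))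
     \<le> (\<Sum>\<xi>\<in>difference_set Y - {0}. F L (circle_mat_vec A \<xi>))"
proof -
  define N where "N y y' m = circle_norm (circle_mat_vec A (y - y') $ m)" for y y' m
  let ?R = "\<Sum>\<xi>\<in>difference_set Y - {0}. F L (circle_mat_vec A \<xi>)"
  let ?G = "\<Pi>\<^sub>E m\<in>(UNIV :: 'm set). {1..L m}"
  have "(real (card Y))\<^sup>2 * (\<Prod>m\<in>UNIV. ln (real (L m) + 1))
      \<le> (real (card Y))\<^sup>2 * (\<Prod>m\<in>UNIV. \<Sum>k=1..L m. 1 / real k)"
    using ln_le_harm
    by (intro mult_left_mono prod_mono) (auto simp: harm_def inverse_eq_divide)
  \<comment> \<open>Expanding the product of harmonic sums gives one term for each partition of the
    torus into boxes.\<close>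
  also have "\<dots> = (\<Sum>k\<in>?G. (real (card Y))\<^sup>2 * (\<Prod>m\<in>UNIV. 1 / real (k m)))"
    by (subst prod_sum_PiE) (auto simp: sum_distrib_left)
  \<comment> \<open>By additivity the image of \<open>y - y'\<close> is a difference of two torus
    points, whose real representatives play the role of \<open>z\<close>.\<close>
  also have "\<dots> \<le> (\<Sum>k\<in>?G. \<Sum>y\<in>Y. \<Sum>y'\<in>Y. \<Prod>m\<in>UNIV. tent (k m) (N y y' m))"
    unfolding N_def circle_mat_vec_diff vector_minus_component circle_norm_diff
    using assms(2) by (intro sum_mono card_sq_le_sum_prod_tent) (auto simp: PiE_iff)
  also have "\<dots> = (\<Sum>y\<in>Y. \<Sum>y'\<in>Y. \<Sum>k\<in>?G. \<Prod>m\<in>UNIV. tent (k m) (N y y' m))"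
    by (subst sum.swap, intro sum.cong refl, rule sum.swap)
  also have "\<dots> = (\<Sum>y\<in>Y. \<Sum>y'\<in>Y. \<Prod>m\<in>UNIV. \<Sum>k=1..L m. tent k (N y y' m))"
    by (simp add: prod_sum_PiE)
  also have "\<dots> \<le> (\<Sum>y\<in>Y. \<Sum>y'\<in>Y. F L (circle_mat_vec A (y - y')))"
    unfolding N_def by (intro sum_mono prod_sum_tent_le_F)
  also have "\<dots> \<le> real (card Y) * (F L (circle_mat_vec A 0) + ?R)"
    by (rule sum_differences_le[OF assms(2) F_nonneg])
  also have "circle_mat_vec A 0 = 0"
    using circle_mat_vec_diff[of A 0 0] by simp
  finally have "real (card Y) * (real (card Y) * (\<Prod>m\<in>UNIV. ln (real (L m) + 1)))
      \<le> real (card Y) * ((\<Prod>m\<in>UNIV. real (L m)) + ?R)"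
    by (simp add: F_zero power2_eq_square mult.assoc)
  moreover have "real (card Y) > 0"
    using assms by (simp add: card_gt_0_iff)
  ultimately show ?thesis
    by simp
qed

end
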